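(* Assume $M\ge2$. The Metropolis-Hastings chain on the circle $\Omega=[0,1]$ with proposal kernel $K_{\mathrm{MH}}(x,A)=\frac1{2c}\lambda(A\cap\{y\in\Omega:d(x,y)<c\})$ and target distribution $\pi=\pi_{M,H}$ has mixing time $\tau_{\mathrm{mix}}$ bounded below by a constant multiple of $e^H$: there is a constant $C>0$ not depending on $H$ such that $\tau_{\mathrm{mix}}\ge C\,e^{H}$ for all $H\ge0$.
   Context: $\Omega=[0,1]$ with $0$ and $1$ identified, with metric $d(x,y)=\min(|x-y|,1-|x-y|)$; $\lambda$ is Lebesgue measure. $M$ is an integer, $H\ge0$, and $0<c<\frac1{4M}$. The target $\pi$ has density $\pi(x)=\frac{2}{1+e^H}$ for $0\le x\le\frac1{2M}$, $\pi(x)=\frac{2e^H}{1+e^H}$ for $\frac1{2M}<x<\frac1M$, extended with period $\frac1M$. The chain at $x$ proposes $y\sim K_{\mathrm{MH}}(x,\cdot)$ and moves to $y$ with probability $\min(1,\pi(y)/\pi(x))$, otherwise stays at $x$. $\tau_{\mathrm{mix}}$ is the usual total variation mixing time: the least $t$ such that $\sup_{x}\|P^t(x,\cdot)-\pi\|_{TV}\le\frac14$ (with $P$ the chain's kernel; $\tau_{\mathrm{mix}}=\infty$ if there is no such $t$). *)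

theory Defs
  imports "HOL-Probability.Probability"
begin

text \<open>
  The circle is represented by the fundamental domain \<open>{0..<1}\<close> of \<open>[0,1]\<close> with \<open>0\<close> and \<open>1\<close>
  identified; \<open>circle\<close> carries Lebesgue measure on the Borel sets.
\<close>

definition circle :: "real measure" where
  "circle = restrict_space lborel {0..<1}"

definition circle_dist :: "real \<Rightarrow> real \<Rightarrow> real" where
  "circle_dist x y = min \<bar>x - y\<bar> (1 - \<bar>x - y\<bar>)"

definition proposal :: "real \<Rightarrow> real \<Rightarrow> real measure" where
  "proposal c x =
     density circle (\<lambda>y. ennreal (1 / (2 * c)) * indicator {y. circle_dist x y < c} y)"

definition target_base :: "nat \<Rightarrow> real \<Rightarrow> real \<Rightarrow> real" where
  "target_base M H r =
     (if r \<le> 1 / (2 * real M) then 2 / (1 + exp H) else 2 * exp H / (1 + exp H))"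

text \<open>For \<open>M > 0\<close>, \<open>frac (M * x) / M\<close> is the representative of \<open>x\<close> modulo \<open>1/M\<close> in \<open>[0, 1/M)\<close>.\<close>

definition target_density :: "nat \<Rightarrow> real \<Rightarrow> real \<Rightarrow> real" where
  "target_density M H x = target_base M H (frac (real M * x) / real M)"

definition target :: "nat \<Rightarrow> real \<Rightarrow> real measure" where
  "target M H = density circle (\<lambda>x. ennreal (target_density M H x))"

definition accept_prob :: "nat \<Rightarrow> real \<Rightarrow> real \<Rightarrow> real \<Rightarrow> real" where
  "accept_prob M H x y = min 1 (target_density M H y / target_density M H x)"

definition mh_kernel :: "nat \<Rightarrow> real \<Rightarrow> real \<Rightarrow> real \<Rightarrow> real measure" where
  "mh_kernel M H c x =
     proposal c x \<bind> (\<lambda>y. distr (measure_pmf (bernoulli_pmf (accept_prob M H x y))) circle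
                              (\<lambda>b. if b then y else x))"

primrec kernel_power ::
  "real measure \<Rightarrow> (real \<Rightarrow> real measure) \<Rightarrow> nat \<Rightarrow> real \<Rightarrow> real measure" where
  "kernel_power S P 0 x = return S x"
| "kernel_power S P (Suc t) x = kernel_power S P t x \<bind> P"

definition tv_dist :: "'a measure \<Rightarrow> 'a measure \<Rightarrow> real" where
  "tv_dist \<mu> \<nu> = (SUP A\<in>sets \<mu>. \<bar>measure \<mu> A - measure \<nu> A\<bar>)"

text \<open>In \<open>enat\<close> the infimum of the empty set is \<open>\<infinity>\<close>.\<close>

definition mixing_time :: "real measure \<Rightarrow> (real \<Rightarrow> real measure) \<Rightarrow> real measure \<Rightarrow> enat" where
  "mixing_time S P \<mu> =
     Inf (enat ` {t. (SUP x\<in>space S. tv_dist (kernel_power S P t x) \<mu>) \<le> 1 / 4})"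

text \<open>
  The lemmas below show that the measures above have total mass one and that the kernels are
  measurable, so that the Giry bind and the real-valued suprema in \<open>tv_dist\<close> and
  \<open>mixing_time\<close> are never applied to degenerate arguments, and give the usual
  accept/reject formula for \<open>mh_kernel\<close>.
\<close>

lemma space_circle: "space circle = {0..<1}"
  by (simp add: circle_def space_restrict_space)

lemma measurable_circle_borel:
  "f \<in> borel_measurable borel \<Longrightarrow> f \<in> borel_measurable circle"
  unfolding circle_def by (rule measurable_restrict_space1) simp

lemma borel_measurable_circle_dist: "circle_dist x \<in> borel_measurable borel"
proof -
  have "(\<lambda>y. min \<bar>x - y\<bar> (1 - \<bar>x - y\<bar>)) \<in> borel_measurable borel" by measurable
  then show ?thesis by (simp add: circle_dist_def[abs_def])
qed

lemma sets_arc: "{y. circle_dist x y < c} \<in> sets borel"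
proof -
  have "{y \<in> space borel. circle_dist x y < c} \<in> sets borel"
    by (rule borel_measurable_less[OF borel_measurable_circle_dist borel_measurable_const])
  then show ?thesis by simp
qed

lemma sets_circleI: "A \<in> sets borel \<Longrightarrow> {0..<1} \<inter> A \<in> sets circle"
  by (auto simp: circle_def sets_restrict_space)

lemma emeasure_proposal:
  assumes A: "A \<in> sets circle"
  shows "emeasure (proposal c x) A =
    ennreal (1 / (2 * c)) * emeasure circle (A \<inter> {y \<in> space circle. circle_dist x y < c})"
proof -
  let ?B = "{y \<in> space circle. circle_dist x y < c}"
  have B: "?B = {0..<1} \<inter> {y. circle_dist x y < c}" by (auto simp: space_circle)
  have m: "?B \<in> sets circle"
    unfolding B by (rule sets_circleI[OF sets_arc])
  have "(\<lambda>y. ennreal (1 / (2 * c)) * indicator {y. circle_dist x y < c} y) \<in> borel_measurable borel"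
    using sets_arc by (intro borel_measurable_times_ennreal borel_measurable_const borel_measurable_indicator)
  then have m2: "(\<lambda>y. ennreal (1 / (2 * c)) * indicator {y. circle_dist x y < c} y) \<in> borel_measurable circle"
    by (rule measurable_circle_borel)
  have "emeasure (proposal c x) A =
     (\<integral>\<^sup>+y. ennreal (1 / (2 * c)) * indicator {y. circle_dist x y < c} y * indicator A y \<partial>circle)"
    unfolding proposal_def by (rule emeasure_density[OF m2 A])
  also have "\<dots> = (\<integral>\<^sup>+y. ennreal (1 / (2 * c)) * indicator (A \<inter> ?B) y \<partial>circle)"
    by (intro nn_integral_cong) (auto simp: indicator_def)
  also have "\<dots> = ennreal (1 / (2 * c)) * emeasure circle (A \<inter> ?B)"
    by (rule nn_integral_cmult_indicator) (rule sets.Int[OF A m])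
  finally show ?thesis .
qed

lemma prob_space_proposal:
  assumes c: "0 < c" "c < 1 / 2" and x: "x \<in> space circle"
  shows "prob_space (proposal c x)"
proof
  let ?B = "{y \<in> space circle. circle_dist x y < c}"
  have x: "0 \<le> x" "x < 1" using x by (auto simp: space_circle)
  have B: "?B = {0..<1} \<inter> {y. circle_dist x y < c}" by (auto simp: space_circle)
  have Bm: "?B \<in> sets lborel" unfolding B using sets_arc by simp
  have e: "emeasure circle ?B = emeasure lborel ?B"
    unfolding circle_def by (rule emeasure_restrict_space) (auto simp: space_restrict_space)
  define I where "I = {max 0 (x - c)<..<min 1 (x + c)}"
  define J where "J = {x + 1 - c<..<1}"
  define K where "K = {0<..<x + c - 1}"
  have disj: "I \<inter> J = {}" "(I \<union> J) \<inter> K = {}"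
    using c by (auto simp: I_def J_def K_def)
  have "AE y in lborel. y \<in> ?B \<longleftrightarrow> y \<in> I \<union> J \<union> K"
    using AE_lborel_singleton[of "0::real"]
  proof eventually_elim
    case (elim y)
    have "y \<in> ?B \<longleftrightarrow> 0 \<le> y \<and> y < 1 \<and> (\<bar>x - y\<bar> < c \<or> 1 - \<bar>x - y\<bar> < c)"
      by (auto simp: space_circle circle_dist_def min_less_iff_disj)
    also have "\<dots> \<longleftrightarrow> y \<in> I \<union> J \<union> K"
      using elim x c by (auto simp: I_def J_def K_def abs_if split: if_splits)
    finally show ?case .
  qed
  then have "emeasure lborel ?B = emeasure lborel (I \<union> J \<union> K)"
    by (rule emeasure_eq_AE) (use Bm in \<open>auto simp: I_def J_def K_def\<close>)
  also have "\<dots> = emeasure lborel (I \<union> J) + emeasure lborel K"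
    by (rule plus_emeasure[symmetric]) (use disj in \<open>auto simp: I_def J_def K_def\<close>)
  also have "emeasure lborel (I \<union> J) = emeasure lborel I + emeasure lborel J"
    by (rule plus_emeasure[symmetric]) (use disj in \<open>auto simp: I_def J_def\<close>)
  also have "emeasure lborel I + emeasure lborel J + emeasure lborel K = ennreal (2 * c)"
  proof -
    have I: "emeasure lborel I = ennreal (min 1 (x + c) - max 0 (x - c))"
      unfolding I_def using x c by (intro emeasure_lborel_Ioo) auto
    have J: "emeasure lborel J = ennreal (max 0 (c - x))"
      unfolding J_def by (cases "x \<le> c") (auto simp: ennreal_neg max_def)
    have K: "emeasure lborel K = ennreal (max 0 (x + c - 1))"
      unfolding K_def by (cases "1 \<le> x + c") (auto simp: max_def)
    show ?thesis
      unfolding I J K using x c by (subst ennreal_plus[symmetric], force, force)+ (rule arg_cong[of _ _ ennreal], auto simp: min_def max_def)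
  qed
  finally have eB: "emeasure circle ?B = ennreal (2 * c)" using e by simp
  have "emeasure (proposal c x) (space circle) = ennreal (1 / (2 * c)) * emeasure circle (space circle \<inter> ?B)"
    by (rule emeasure_proposal) simp
  also have "space circle \<inter> ?B = ?B" by auto
  also have "ennreal (1 / (2 * c)) * emeasure circle ?B = 1"
    unfolding eB using c by (simp flip: ennreal_mult)
  finally show "emeasure (proposal c x) (space (proposal c x)) = 1"
    by (simp add: proposal_def)
qed

lemma target_density_pos: "0 < target_density M H x"
  by (simp add: target_density_def target_base_def add_pos_pos)

lemma accept_prob_bounds: "0 \<le> accept_prob M H x y" "accept_prob M H x y \<le> 1"
  using target_density_pos[of M H x] target_density_pos[of M H y] by (auto simp: accept_prob_def)

lemma borel_measurable_target_density: "target_density M H \<in> borel_measurable borel"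
proof -
  have "(\<lambda>x. frac (real M * x) / real M) \<in> borel_measurable borel"
    unfolding frac_def by measurable
  then have "(\<lambda>x. target_base M H (frac (real M * x) / real M)) \<in> borel_measurable borel"
    unfolding target_base_def by measurable
  then show ?thesis by (simp add: target_density_def[abs_def])
qed

lemma borel_measurable_accept_prob:
  "(\<lambda>z. accept_prob M H (fst z) (snd z)) \<in> borel_measurable (borel \<Otimes>\<^sub>M borel)"
proof -
  note borel_measurable_target_density[measurable]
  show ?thesis unfolding accept_prob_def by measurable
qed

lemma id_circle_borel: "(\<lambda>x. x) \<in> circle \<rightarrow>\<^sub>M borel"
  by (rule measurable_circle_borel) simp

lemma emeasure_accept_step:
  assumes A: "A \<in> sets circle" and x: "x \<in> space circle" and y: "y \<in> space circle" and p: "0 \<le> p" "p \<le> 1"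
  shows "emeasure (distr (measure_pmf (bernoulli_pmf p)) circle (\<lambda>b. if b then y else x)) A =
     ennreal p * indicator A y + ennreal (1 - p) * indicator A x"
proof -
  have m: "(\<lambda>b. if b then y else x) \<in> measure_pmf (bernoulli_pmf p) \<rightarrow>\<^sub>M circle"
    using x y by auto
  have "emeasure (distr (measure_pmf (bernoulli_pmf p)) circle (\<lambda>b. if b then y else x)) A
    = emeasure (measure_pmf (bernoulli_pmf p)) ((\<lambda>b. if b then y else x) -` A)"
    using emeasure_distr[OF m A] by simp
  also have "\<dots> = (\<integral>\<^sup>+b. indicator A (if b then y else x) \<partial>measure_pmf (bernoulli_pmf p))"
  proof -
    have "indicator A (if b then y else x) = (indicator ((\<lambda>b. if b then y else x) -` A) b :: ennreal)" for b
      by (simp add: indicator_def)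
    then show ?thesis by simp
  qed
  also have "\<dots> = ennreal p * indicator A y + ennreal (1 - p) * indicator A x"
    using p by (simp add: mult.commute)
  finally show ?thesis .
qed

lemma measurable_accept_step:
  "(\<lambda>(x, y). distr (measure_pmf (bernoulli_pmf (accept_prob M H x y))) circle (\<lambda>b. if b then y else x))
    \<in> circle \<Otimes>\<^sub>M circle \<rightarrow>\<^sub>M prob_algebra circle" (is "?f \<in> _")
proof (rule measurable_prob_algebraI)
  fix z assume "z \<in> space (circle \<Otimes>\<^sub>M circle)"
  then obtain x y where z: "z = (x, y)" "x \<in> space circle" "y \<in> space circle"
    by (auto simp: space_pair_measure)
  then show "prob_space (?f z)"
    by (auto intro!: prob_space.prob_space_distr prob_space_measure_pmf)
next
  show "?f \<in> circle \<Otimes>\<^sub>M circle \<rightarrow>\<^sub>M subprob_algebra circle"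
  proof (rule measurable_subprob_algebra)
    fix z assume "z \<in> space (circle \<Otimes>\<^sub>M circle)"
    then obtain x y where z: "z = (x, y)" "x \<in> space circle" "y \<in> space circle"
      by (auto simp: space_pair_measure)
    then show "subprob_space (?f z)" 
      by (auto intro!: prob_space_imp_subprob_space prob_space.prob_space_distr prob_space_measure_pmf)
    show "sets (?f z) = sets circle" by (simp add: z)
  next
    fix A assume A: "A \<in> sets circle"
    have id: "(\<lambda>z. z) \<in> circle \<Otimes>\<^sub>M circle \<rightarrow>\<^sub>M borel \<Otimes>\<^sub>M borel"
      using measurable_compose[OF measurable_fst id_circle_borel]
        measurable_compose[OF measurable_snd id_circle_borel]
      by (intro measurable_pair) (simp_all add: comp_def)
    have [measurable]: "(\<lambda>z. accept_prob M H (fst z) (snd z)) \<in> borel_measurable (circle \<Otimes>\<^sub>M circle)"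
      by (rule measurable_compose[OF id borel_measurable_accept_prob])
    note A[measurable]
    have "(\<lambda>z. ennreal (accept_prob M H (fst z) (snd z)) * indicator A (snd z) +
       ennreal (1 - accept_prob M H (fst z) (snd z)) * indicator A (fst z)) \<in> borel_measurable (circle \<Otimes>\<^sub>M circle)"
      by measurable
    then show "(\<lambda>z. emeasure (?f z) A) \<in> borel_measurable (circle \<Otimes>\<^sub>M circle)"
      by (rule measurable_cong[THEN iffD1, rotated])
         (auto simp: space_pair_measure emeasure_accept_step[OF A] accept_prob_bounds)
  qed
qed

lemma measurable_proposal:
  assumes c: "0 < c" "c < 1 / 2"
  shows "proposal c \<in> circle \<rightarrow>\<^sub>M prob_algebra circle"
proof (rule measurable_prob_algebraI)
  fix x assume "x \<in> space circle"
  then show "prob_space (proposal c x)" by (rule prob_space_proposal[OF c])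
next
  show "proposal c \<in> circle \<rightarrow>\<^sub>M subprob_algebra circle"
  proof (rule measurable_subprob_algebra)
    fix x assume "x \<in> space circle"
    then show "subprob_space (proposal c x)"
      by (intro prob_space_imp_subprob_space prob_space_proposal[OF c])
    show "sets (proposal c x) = sets circle" by (simp add: proposal_def)
  next
    fix A assume A: "A \<in> sets circle"
    have id: "(\<lambda>z. z) \<in> circle \<Otimes>\<^sub>M circle \<rightarrow>\<^sub>M borel \<Otimes>\<^sub>M borel"
      using measurable_compose[OF measurable_fst id_circle_borel]
        measurable_compose[OF measurable_snd id_circle_borel]
      by (intro measurable_pair) (simp_all add: comp_def)
    have "(\<lambda>z. circle_dist (fst z) (snd z)) \<in> borel_measurable (borel \<Otimes>\<^sub>M borel)"
      unfolding circle_dist_def by measurable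
    from measurable_compose[OF id this]
    have [measurable]: "(\<lambda>z. circle_dist (fst z) (snd z)) \<in> borel_measurable (circle \<Otimes>\<^sub>M circle)" .
    interpret C: sigma_finite_measure circle
      unfolding circle_def by (intro sigma_finite_measure_restrict_space lborel.sigma_finite_measure_axioms) auto
    note A[measurable]
    define g :: "real \<Rightarrow> real \<Rightarrow> ennreal" where
      "g x y = (if circle_dist x y < c then ennreal (1 / (2 * c)) * indicator A y else 0)" for x y
    have "(\<lambda>z. g (fst z) (snd z)) \<in> borel_measurable (circle \<Otimes>\<^sub>M circle)"
      unfolding g_def by measurable
    then have "(\<lambda>x. \<integral>\<^sup>+y. g x y \<partial>circle) \<in> borel_measurable circle"
      using C.borel_measurable_nn_integral[of g circle] by (simp add: case_prod_beta')
    moreover have "emeasure (proposal c x) A = (\<integral>\<^sup>+y. g x y \<partial>circle)" for x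
    proof -
      have "(\<lambda>y. ennreal (1 / (2 * c)) * indicator {y. circle_dist x y < c} y) \<in> borel_measurable borel"
        using sets_arc by (intro borel_measurable_times_ennreal borel_measurable_const borel_measurable_indicator)
      then have m2: "(\<lambda>y. ennreal (1 / (2 * c)) * indicator {y. circle_dist x y < c} y) \<in> borel_measurable circle"
        by (rule measurable_circle_borel)
      show ?thesis
        unfolding proposal_def emeasure_density[OF m2 A]
        by (intro nn_integral_cong) (auto simp: g_def indicator_def)
    qed
    ultimately show "(\<lambda>x. emeasure (proposal c x) A) \<in> borel_measurable circle" by simp
  qed
qed

lemma measurable_mh_kernel:
  assumes c: "0 < c" "c < 1 / 2"
  shows "mh_kernel M H c \<in> circle \<rightarrow>\<^sub>M prob_algebra circle"
  unfolding mh_kernel_def[abs_def]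
  by (rule measurable_bind_prob_space2[OF measurable_proposal[OF c]])
     (use measurable_accept_step in \<open>simp add: case_prod_beta'\<close>)

lemma emeasure_mh_kernel:
  assumes c: "0 < c" "c < 1 / 2" and x: "x \<in> space circle" and A: "A \<in> sets circle"
  shows "emeasure (mh_kernel M H c x) A =
    (\<integral>\<^sup>+y. ennreal (accept_prob M H x y) * indicator A y \<partial>proposal c x) +
    (\<integral>\<^sup>+y. ennreal (1 - accept_prob M H x y) \<partial>proposal c x) * indicator A x"
proof -
  let ?f = "\<lambda>y. distr (measure_pmf (bernoulli_pmf (accept_prob M H x y))) circle (\<lambda>b. if b then y else x)"
  have sp: "space (proposal c x) = space circle" by (simp add: proposal_def)
  have [measurable_cong]: "sets (proposal c x) = sets circle" by (simp add: proposal_def)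
  have f: "?f \<in> proposal c x \<rightarrow>\<^sub>M subprob_algebra circle"
    using measurable_compose[OF measurable_Pair1'[OF x] measurable_prob_algebraD[OF measurable_accept_step]]
    by (simp cong: measurable_cong_sets)
  have "(\<lambda>y. (x, y)) \<in> borel \<rightarrow>\<^sub>M borel \<Otimes>\<^sub>M borel" by measurable
  from measurable_circle_borel[OF measurable_compose[OF this borel_measurable_accept_prob]]
  have [measurable]: "accept_prob M H x \<in> borel_measurable circle" by simp
  note A[measurable]
  have "emeasure (mh_kernel M H c x) A = (\<integral>\<^sup>+y. emeasure (?f y) A \<partial>proposal c x)"
    unfolding mh_kernel_def using x by (intro emeasure_bind[OF _ f A]) (auto simp: sp)
  also have "\<dots> = (\<integral>\<^sup>+y. ennreal (accept_prob M H x y) * indicator A y +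
      ennreal (1 - accept_prob M H x y) * indicator A x \<partial>proposal c x)"
    by (intro nn_integral_cong) (auto simp: sp emeasure_accept_step[OF A x] accept_prob_bounds)
  also have "\<dots> = (\<integral>\<^sup>+y. ennreal (accept_prob M H x y) * indicator A y \<partial>proposal c x) +
      (\<integral>\<^sup>+y. ennreal (1 - accept_prob M H x y) * indicator A x \<partial>proposal c x)"
    by (rule nn_integral_add) measurable
  also have "(\<integral>\<^sup>+y. ennreal (1 - accept_prob M H x y) * indicator A x \<partial>proposal c x) =
      (\<integral>\<^sup>+y. ennreal (1 - accept_prob M H x y) \<partial>proposal c x) * indicator A x"
    by (rule nn_integral_multc) measurable
  finally show ?thesis .
qed

lemma kernel_power_mh:
  assumes c: "0 < c" "c < 1 / 2" and x: "x \<in> space circle"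
  shows "prob_space (kernel_power circle (mh_kernel M H c) t x)"
    and "sets (kernel_power circle (mh_kernel M H c) t x) = sets circle"
proof -
  have "kernel_power circle (mh_kernel M H c) t \<in> circle \<rightarrow>\<^sub>M prob_algebra circle"
  proof (induction t)
    case 0
    have "return circle \<in> circle \<rightarrow>\<^sub>M prob_algebra circle"
      by (rule measurable_prob_algebraI) (auto intro: prob_space_return)
    then show ?case by simp
  next
    case (Suc t)
    then show ?case
      using measurable_bind_prob_space[OF Suc measurable_mh_kernel[OF c]] by simp
  qed
  from measurable_space[OF this x]
  have "kernel_power circle (mh_kernel M H c) t x \<in> space (prob_algebra circle)" .
  then show "prob_space (kernel_power circle (mh_kernel M H c) t x)"
    and "sets (kernel_power circle (mh_kernel M H c) t x) = sets circle"
    by (auto simp: space_prob_algebra)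
qed

lemma prob_space_target:
  assumes M: "M > 0"
  shows "prob_space (target M H)"
proof
  define a b where "a = 2 / (1 + exp H)" and "b = 2 * exp H / (1 + exp H)"
  define w where "w = 1 / (2 * real M)"
  define h where "h = 1 / real M"
  have h: "h = 2 * w" "0 < w" using M by (auto simp: h_def w_def)
  then have "w < h" by simp
  have pos: "0 < a" "0 < b" by (auto simp: a_def b_def add_pos_pos)
  have ab: "a + b = 2"
  proof -
    have "1 + exp H \<noteq> (0::real)" using exp_gt_zero[of H] by linarith
    then show ?thesis unfolding a_def b_def add_divide_distrib[symmetric] by (simp add: divide_eq_eq)
  qed
  have td: "target_density M H x = (if x - k * h \<le> w then a else b)" if "k * h \<le> x" "x < (k + 1) * h" and k: "k = real n" for x k n
  proof -
    have "k \<le> real M * x" "real M * x < k + 1"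
      using that M by (auto simp: h_def field_simps)
    then have "\<lfloor>real M * x\<rfloor> = int n" using k by linarith
    then have "frac (real M * x) / real M = x - k * h"
      using M k by (simp add: frac_def h_def field_simps)
    then show ?thesis
      unfolding target_density_def target_base_def a_def b_def w_def by simp
  qed
  define I where "I n = {real n * h..<(real n + 1) * h}" for n
  have meas: "(\<lambda>x. ennreal (target_density M H x)) \<in> borel_measurable borel"
    using borel_measurable_target_density by measurable
  have one: "(\<integral>\<^sup>+x. ennreal (target_density M H x) * indicator (I n) x \<partial>lborel) = ennreal h" for n
  proof -
    let ?k = "real n"
    have "(\<integral>\<^sup>+x. ennreal (target_density M H x) * indicator (I n) x \<partial>lborel) =
      (\<integral>\<^sup>+x. ennreal a * indicator {?k*h..?k*h+w} x + ennreal b * indicator {?k*h+w<..<?k*h+h} x \<partial>lborel)"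
    proof (intro nn_integral_cong)
      fix x
      show "ennreal (target_density M H x) * indicator (I n) x =
        ennreal a * indicator {?k*h..?k*h+w} x + ennreal b * indicator {?k*h+w<..<?k*h+h} x"
      proof (cases "x \<in> I n")
        case True
        then have "?k * h \<le> x" "x < (?k + 1) * h" by (auto simp: I_def)
        from td[OF this refl] this show ?thesis
          using True h by (auto simp: indicator_def algebra_simps)
      next
        case False
        then show ?thesis using h by (auto simp: indicator_def algebra_simps I_def)
      qed
    qed
    also have "\<dots> = ennreal a * ennreal w + ennreal b * ennreal w"
      using h by (subst nn_integral_add) (auto simp: nn_integral_cmult_indicator)
    also have "\<dots> = ennreal h"
    proof -
      have "a * w + b * w = h" using ab h by (metis distrib_right)
      then show ?thesis using pos h by (simp flip: ennreal_mult ennreal_plus)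
    qed
    finally show ?thesis .
  qed
  have cover: "indicator {0..<real k * h} x = (\<Sum>n<k. indicator (I n) x :: ennreal)" for x k
  proof (induction k)
    case (Suc k)
    have k0: "0 \<le> real k * h" and k1: "real (Suc k) * h = real k * h + h" using h by (auto simp: algebra_simps)
    have k2: "0 \<le> x" if "real k * h \<le> x" using k0 that by linarith
    have "indicator {0..<real (Suc k) * h} x = (indicator {0..<real k * h} x + indicator (I k) x :: ennreal)"
      using k2 k1 \<open>w < h\<close> \<open>0 < w\<close> by (auto simp: I_def distrib_right indicator_def)
    then show ?case using Suc by simp
  qed simp
  have Mh: "real M * h = 1" using M by (simp add: h_def)
  have "emeasure (target M H) (space (target M H)) = (\<integral>\<^sup>+x. ennreal (target_density M H x) \<partial>circle)"
    unfolding target_def using measurable_circle_borel[OF meas]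
    by (simp add: emeasure_density cong: nn_integral_cong)
  also have "\<dots> = (\<integral>\<^sup>+x. ennreal (target_density M H x) * indicator {0..<1} x \<partial>lborel)"
    unfolding circle_def by (rule nn_integral_restrict_space) simp
  also have "\<dots> = (\<integral>\<^sup>+x. (\<Sum>n<M. ennreal (target_density M H x) * indicator (I n) x) \<partial>lborel)"
    using cover[of M] by (simp add: Mh sum_distrib_left)
  also have "\<dots> = (\<Sum>n<M. \<integral>\<^sup>+x. ennreal (target_density M H x) * indicator (I n) x \<partial>lborel)"
    by (rule nn_integral_sum) (use meas in \<open>auto simp: I_def\<close>)
  also have "\<dots> = ennreal (real M * h)"
    using one h by (simp add: ennreal_of_nat_eq_real_of_nat ennreal_mult)
  finally show "emeasure (target M H) (space (target M H)) = 1" by (simp add: Mh)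
qed

end

theory Submission
  imports Defs
begin

text \<open>
  Start the chain in the well \<open>A = (1/(2M), 1/M)\<close>, where the density is high. The neighbouring
  barriers are wider than \<open>c\<close>, so a step leaving \<open>A\<close> must land in a low-density region, and such a
  proposal is accepted with probability \<open>e\<^sup>-\<^sup>H\<close> only. After \<open>t\<close> steps the chain has therefore left \<open>A\<close>
  with probability at most \<open>t e\<^sup>-\<^sup>H\<close>, whereas the target gives \<open>A\<close> mass at most \<open>1/M \<le> 1/2\<close>.
\<close>

lemma kernel_power_measurable:
  assumes "P \<in> S \<rightarrow>\<^sub>M prob_algebra S"
  shows "kernel_power S P t \<in> S \<rightarrow>\<^sub>M prob_algebra S"
proof (induction t)
  case 0
  have "return S \<in> S \<rightarrow>\<^sub>M prob_algebra S"
    by (rule measurable_prob_algebraI) (auto intro: prob_space_return)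
  then show ?case by simp
next
  case (Suc t)
  then show ?case using measurable_bind_prob_space[OF Suc assms] by simp
qed

text \<open>Union bound over the steps: mass found in \<open>B\<close> after a step was either there
  before or entered in that step. Returns from \<open>B\<close> are ignored, so \<open>B\<close>
  need not be absorbing.\<close>

lemma kernel_power_escape_le:
  assumes P: "P \<in> S \<rightarrow>\<^sub>M prob_algebra S" and B: "B \<in> sets S"
    and x: "x \<in> space S" "x \<notin> B"
    and step: "\<And>y. y \<in> space S \<Longrightarrow> y \<notin> B \<Longrightarrow> emeasure (P y) B \<le> \<epsilon>"
  shows "emeasure (kernel_power S P t x) B \<le> of_nat t * \<epsilon>"
proof (induction t)
  case 0
  then show ?case using x B by simp
next
  case (Suc t)
  let ?N = "kernel_power S P t x"
  have N: "prob_space ?N" "sets ?N = sets S"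
    using measurable_space[OF kernel_power_measurable[OF P] x(1)] by (auto simp: space_prob_algebra)
  then have sp: "space ?N = space S" by (auto dest: sets_eq_imp_space_eq)
  have Pm: "P \<in> ?N \<rightarrow>\<^sub>M subprob_algebra S"
    using measurable_prob_algebraD[OF P] by (simp add: measurable_cong_sets[OF N(2) refl])
  have "emeasure (kernel_power S P (Suc t) x) B = (\<integral>\<^sup>+y. emeasure (P y) B \<partial>?N)"
    using x by (simp, intro emeasure_bind[OF _ Pm B]) (auto simp: sp)
  \<comment> \<open>One bound valid everywhere: on \<open>B\<close> the indicator covers the trivial
    value 1, off \<open>B\<close> the hypothesis \<open>step\<close> gives
    \<open>\<epsilon>\<close>.\<close>
  also have "\<dots> \<le> (\<integral>\<^sup>+y. indicator B y + \<epsilon> \<partial>?N)"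
  proof (intro nn_integral_mono)
    fix y assume y: "y \<in> space ?N"
    then have "prob_space (P y)"
      using measurable_space[OF P] by (auto simp: sp space_prob_algebra)
    then have "emeasure (P y) B \<le> 1"
      by (metis prob_space.measure_le_1)
    then show "emeasure (P y) B \<le> indicator B y + \<epsilon>"
      using step[of y] y by (cases "y \<in> B") (auto simp: sp add_increasing2)
  qed
  also have "\<dots> = emeasure ?N B + \<epsilon>"
    using N B by (simp add: nn_integral_add prob_space.emeasure_space_1)
  also have "\<dots> \<le> of_nat (Suc t) * \<epsilon>"
    using Suc by (simp add: algebra_simps add_left_mono)
  finally show ?case .
qed

lemma abs_measure_diff_le_1:
  assumes "prob_space \<mu>" "prob_space \<nu>"
  shows "\<bar>measure \<mu> A - measure \<nu> A\<bar> \<le> 1"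
  using prob_space.prob_le_1[OF assms(1), of A] prob_space.prob_le_1[OF assms(2), of A]
    measure_nonneg[of \<mu> A] measure_nonneg[of \<nu> A] by linarith

lemma tv_dist_ge:
  assumes "prob_space \<mu>" "prob_space \<nu>" "A \<in> sets \<mu>"
  shows "\<bar>measure \<mu> A - measure \<nu> A\<bar> \<le> tv_dist \<mu> \<nu>"
  \<comment> \<open>A real-valued \<open>SUP\<close> is sure to dominate its terms only over a
    family bounded above; the bound 1 supplies this.\<close>
  unfolding tv_dist_def using abs_measure_diff_le_1[OF assms(1,2)]
  by (intro cSUP_upper assms bdd_aboveI2[where M = 1])

lemma tv_dist_le_1:
  assumes "prob_space \<mu>" "prob_space \<nu>"
  shows "tv_dist \<mu> \<nu> \<le> 1"
  unfolding tv_dist_def using abs_measure_diff_le_1[OF assms]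
  by (intro cSUP_least) (auto intro: sets.top)

lemma mixing_time_ge:
  assumes P: "P \<in> S \<rightarrow>\<^sub>M prob_algebra S" and \<mu>: "prob_space \<mu>" and x: "x \<in> space S"
    and far: "\<And>t. tv_dist (kernel_power S P t x) \<mu> \<le> 1 / 4 \<Longrightarrow> b \<le> real t"
  shows "ereal b \<le> ereal_of_enat (mixing_time S P \<mu>)"
proof -
  let ?T = "{t. (SUP x\<in>space S. tv_dist (kernel_power S P t x) \<mu>) \<le> 1 / 4}"
  have T: "b \<le> real t" if "t \<in> ?T" for t
  proof (rule far)
    have "prob_space (kernel_power S P t y)" if "y \<in> space S" for y
      using measurable_space[OF kernel_power_measurable[OF P] that] by (auto simp: space_prob_algebra)
    then have "tv_dist (kernel_power S P t x) \<mu> \<le> (SUP x\<in>space S. tv_dist (kernel_power S P t x) \<mu>)"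
      using \<mu> by (intro cSUP_upper x bdd_aboveI2[where M = 1] tv_dist_le_1) auto
    with that show "tv_dist (kernel_power S P t x) \<mu> \<le> 1 / 4" by simp
  qed
  show ?thesis
  proof (cases "?T = {}")
    case True
    then show ?thesis unfolding mixing_time_def True by (simp add: top_enat_def)
  next
    case False
    \<comment> \<open>A nonempty set of naturals attains its infimum, so the mixing time is itself a
      member of \<open>?T\<close>.\<close>
    then have "Inf (enat ` ?T) \<in> enat ` ?T" by (auto simp: Inf_enat_def intro: LeastI)
    then obtain t where "t \<in> ?T" "mixing_time S P \<mu> = enat t"
      unfolding mixing_time_def by auto
    with T show ?thesis by simp
  qed
qed

text \<open>The high-density half of the first period, where \<open>frac\<close> acts trivially on
  \<open>real M * x\<close>. Both endpoints are excluded because the density is low there.\<close>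

definition well :: "nat \<Rightarrow> real set" where
  "well M = {1 / (2 * real M)<..<1 / real M}"

lemma well_subset_circle: "M > 0 \<Longrightarrow> well M \<subseteq> {0..<1}"
proof
  fix x assume M: "M > 0" and "x \<in> well M"
  then have "1 / (2 * real M) < x" "x < 1 / real M" by (auto simp: well_def)
  moreover have "0 < 1 / (2 * real M)" "1 / real M \<le> 1" using M by auto
  ultimately show "x \<in> {0..<1}" unfolding atLeastLessThan_iff by linarith
qed

lemma sets_well: "M > 0 \<Longrightarrow> well M \<in> sets circle"
  using sets_circleI[of "well M"] well_subset_circle[of M] by (simp add: well_def Int_absorb1)

lemma target_density_le_2: "target_density M H x \<le> 2"
  by (simp add: target_density_def target_base_def divide_le_eq add_pos_pos)

lemma target_density_well:
  assumes M: "M > 0" and x: "x \<in> well M"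
  shows "target_density M H x = 2 * exp H / (1 + exp H)"
proof -
  have "0 \<le> x" "x < 1 / real M" "1 / (2 * real M) < x"
    using well_subset_circle[OF M] x by (auto simp: well_def)
  then have "frac (real M * x) = real M * x"
    using M by (simp add: frac_eq field_simps)
  then show ?thesis using M x by (auto simp: target_density_def target_base_def well_def)
qed

lemma target_density_near_well:
  assumes M: "M > 0" and c: "c < 1 / (4 * real M)" and x: "x \<in> well M"
    and y: "y \<in> space circle" "y \<notin> well M" and d: "circle_dist x y < c"
  shows "target_density M H y = 2 / (1 + exp H)"
proof -
  \<comment> \<open>A quarter period as unit: the well is (2u, 4u), the period is 4u, and c <
    u.\<close>
  define u where "u = 1 / (4 * real M)"
  have u: "0 < u" "1 / (2 * real M) = 2 * u" "1 / real M = 4 * u" "real M * (4 * u) = 1"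
    using M by (auto simp: u_def)
  have x2: "2 * u < x" "x < 4 * u" using x u by (auto simp: well_def)
  have y2: "0 \<le> y" "y < 1" using y by (auto simp: space_circle)
  have c': "c < u" using c by (simp add: u_def)
  \<comment> \<open>To the left of the well every point is in the low half-period; only on the right
    does the distance bound matter.\<close>
  consider "y \<le> 2 * u" | "4 * u \<le> y" using y(2) u by (force simp: well_def)
  then have "frac (real M * y) / real M \<le> 2 * u"
  proof cases
    case 1
    then have "real M * y \<le> real M * (2 * u)" by (intro mult_left_mono) auto
    then have "real M * y < 1" using u(4) by linarith
    then have "frac (real M * y) = real M * y" using y2 by (simp add: frac_eq)
    then show ?thesis using 1 M by simp
  next
    case 2
    \<comment> \<open>Wrapping around through 0 is impossible: it would need y > x + 1 - c, which
      exceeds 1 since x > 2u > c.\<close>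
    have "y < 5 * u" using d x2 2 y2 c' by (auto simp: circle_dist_def min_less_iff_disj)
    then have "real M * y < real M * (5 * u)" using M by simp
    moreover have "real M * (4 * u) \<le> real M * y" using 2 by (intro mult_left_mono) auto
    ultimately have "\<lfloor>real M * y\<rfloor> = 1" using u(4) by (simp add: floor_eq_iff)
    then have "frac (real M * y) / real M = y - 1 / real M"
      using M by (simp add: frac_def field_simps)
    then show ?thesis using \<open>y < 5 * u\<close> u by linarith
  qed
  then show ?thesis by (simp add: target_density_def target_base_def u)
qed

lemma mh_kernel_escape_well:
  assumes M: "M > 0" and c: "0 < c" "c < 1 / (4 * real M)" and x: "x \<in> well M"
  shows "emeasure (mh_kernel M H c x) (space circle - well M) \<le> ennreal (exp (- H))"
proof -
  have "1 / (4 * real M) \<le> 1 / 4" using M by (simp add: field_simps)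
  then have c2: "c < 1 / 2" using c by linarith
  have xc: "x \<in> space circle" using well_subset_circle[OF M] x by (auto simp: space_circle)
  let ?B = "space circle - well M"
  have B: "?B \<in> sets circle" using sets_well[OF M] by auto
  have dens: "(\<lambda>y. ennreal (1 / (2 * c)) * indicator {y. circle_dist x y < c} y) \<in> borel_measurable circle"
    using sets_arc by (intro measurable_circle_borel borel_measurable_times_ennreal
        borel_measurable_const borel_measurable_indicator)
  have near: "AE y in proposal c x. y \<in> space circle \<and> circle_dist x y < c"
    unfolding proposal_def AE_density[OF dens] by (intro AE_I2) (auto simp: indicator_def)
  have "emeasure (mh_kernel M H c x) ?B =
      (\<integral>\<^sup>+y. ennreal (accept_prob M H x y) * indicator ?B y \<partial>proposal c x)"
    \<comment> \<open>The rejection term vanishes, since a rejected move stays at \<open>x\<close>,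
      outside \<open>?B\<close>.\<close>
    using emeasure_mh_kernel[OF c(1) c2 xc B] x by simp
  also have "\<dots> \<le> (\<integral>\<^sup>+y. ennreal (exp (- H)) \<partial>proposal c x)"
  proof (intro nn_integral_mono_AE, use near in eventually_elim)
    case (elim y)
    show ?case
    proof (cases "y \<in> ?B")
      case True
      \<comment> \<open>Here \<open>s\<close> stands for the normalisation \<open>1 + exp H\<close>,
        which cancels in the density ratio.\<close>
      have "2 / s / (2 * exp H / s) = exp (- H)" if "s \<noteq> 0" for s
        using that by (simp add: exp_minus field_simps)
      moreover have "1 + exp H \<noteq> 0" using exp_gt_zero[of H] by linarith
      moreover have "target_density M H y = 2 / (1 + exp H)"
        using True elim by (intro target_density_near_well[OF M c(2) x]) auto
      ultimately have "target_density M H y / target_density M H x = exp (- H)"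
        by (simp only: target_density_well[OF M x] not_False_eq_True)
      then show ?thesis using True by (simp add: accept_prob_def)
    qed simp
  qed
  also have "\<dots> = ennreal (exp (- H))"
    using prob_space.emeasure_space_1[OF prob_space_proposal[OF c(1) c2 xc]] by simp
  finally show ?thesis .
qed

lemma measure_target_well_le:
  assumes M: "M > 0"
  shows "measure (target M H) (well M) \<le> 1 / real M"
proof -
  have dens: "(\<lambda>x. ennreal (target_density M H x)) \<in> borel_measurable circle"
    using borel_measurable_target_density by (intro measurable_circle_borel) measurable
  have "emeasure (target M H) (well M) =
      (\<integral>\<^sup>+x. ennreal (target_density M H x) * indicator (well M) x \<partial>circle)"
    unfolding target_def by (rule emeasure_density[OF dens sets_well[OF M]])
  \<comment> \<open>The density is at most 2 uniformly in \<open>H\<close>, and the well has length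
    1/(2M).\<close>
  also have "\<dots> \<le> (\<integral>\<^sup>+x. 2 * indicator (well M) x \<partial>circle)"
    using target_density_le_2[of M H]
    by (intro nn_integral_mono mult_right_mono) (auto intro: ennreal_leI[of _ 2, simplified])
  also have "\<dots> = 2 * emeasure circle (well M)"
    by (rule nn_integral_cmult_indicator[OF sets_well[OF M]])
  also have "emeasure circle (well M) = emeasure lborel (well M)"
    unfolding circle_def using well_subset_circle[OF M] by (intro emeasure_restrict_space) auto
  also have "\<dots> = ennreal (1 / real M - 1 / (2 * real M))"
    unfolding well_def using M by (intro emeasure_lborel_Ioo) (simp add: field_simps)
  also have "2 * \<dots> = ennreal (1 / real M)"
    using M by (subst ennreal_numeral[symmetric], subst ennreal_mult[symmetric]) (auto simp: field_simps)
  finally show ?thesis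
    unfolding measure_def by (intro enn2real_leI) auto
qed

theorem theorem4:
  fixes M :: nat and c :: real
  assumes "M \<ge> 2" and "0 < c" and "c < 1 / (4 * real M)"
  shows "\<exists>C>0. \<forall>H\<ge>0.
    ereal (C * exp H) \<le> ereal_of_enat (mixing_time circle (mh_kernel M H c) (target M H))"
\<comment> \<open>The constant is what remains of the mass 1: at most 1/2 is the target mass of the
  well and 1/4 is the total variation threshold.\<close>
proof (intro exI[of _ "1 / 4"] conjI allI impI)
  fix H :: real
  have M: "M > 0" using assms by simp
  have "1 / (4 * real M) \<le> 1 / 4" using M by (simp add: field_simps)
  then have c2: "c < 1 / 2" using assms by linarith
  note P = measurable_mh_kernel[OF assms(2) c2, of M H]
  let ?B = "space circle - well M"
  have "1 / (2 * real M) < 1 / real M" using M by (simp add: field_simps)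
  from dense[OF this] obtain x where x: "x \<in> well M"
    by (auto simp: well_def)
  have xc: "x \<in> space circle" using well_subset_circle[OF M] x by (auto simp: space_circle)
  show "ereal (1 / 4 * exp H) \<le> ereal_of_enat (mixing_time circle (mh_kernel M H c) (target M H))"
  proof (rule mixing_time_ge[OF P prob_space_target[OF M] xc])
    fix t
    let ?N = "kernel_power circle (mh_kernel M H c) t x"
    assume tv: "tv_dist ?N (target M H) \<le> 1 / 4"
    note N = kernel_power_mh[OF assms(2) c2 xc, of M H t]
    have spN: "space ?N = space circle" by (rule sets_eq_imp_space_eq[OF N(2)])
    have A: "well M \<in> sets ?N" using sets_well[OF M] N by simp
    have "emeasure ?N ?B \<le> of_nat t * ennreal (exp (- H))"
      using sets_well[OF M] x mh_kernel_escape_well[OF M assms(2,3)]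
      by (intro kernel_power_escape_le[OF P _ xc]) auto
    then have "emeasure ?N ?B \<le> ennreal (real t * exp (- H))"
      by (simp add: ennreal_mult ennreal_of_nat_eq_real_of_nat)
    then have "measure ?N ?B \<le> real t * exp (- H)"
      unfolding measure_def by (intro enn2real_leI) auto
    moreover have "measure ?N ?B = 1 - measure ?N (well M)"
      using prob_space.prob_compl[OF N(1) A] spN by simp
    \<comment> \<open>Here \<open>M \<ge> 2\<close> enters: the target mass of a single well stays
      at most 1/2 however large \<open>H\<close> is.\<close>
    moreover have "1 / real M \<le> 1 / 2" using assms(1) by (simp add: field_simps)
    moreover have "\<bar>measure ?N (well M) - measure (target M H) (well M)\<bar> \<le> 1 / 4"
      using tv_dist_ge[OF N(1) prob_space_target[OF M] A] tv by (rule order_trans)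
    \<comment> \<open>With N the law after \<open>t\<close> steps: 1 - t exp(-H) \<le> N(well) \<le>
      target(well) + 1/4 \<le> 3/4.\<close>
    ultimately have "1 / 4 \<le> real t * exp (- H)"
      using measure_target_well_le[OF M, of H] by linarith
    then show "1 / 4 * exp H \<le> real t"
      by (simp add: exp_minus field_simps)
  qed
qed simp

end
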